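(* Let $a$ be an odd positive integer and $m$ a positive integer. For every positive integer $n$, $$t(a,3a,8m;n)=\frac 23N(a,3a,8m;8n+4a+8m)-2N(a,3a,8m;2n+a+2m).$$
   Context: For positive integers $a_1,\dots,a_k$ and a nonnegative integer $n$, $N(a_1,\dots,a_k;n)$ is the number of $(x_1,\dots,x_k)\in\mathbb Z^k$ with $n=a_1x_1^2+\cdots+a_kx_k^2$, and $t(a_1,\dots,a_k;n)$ is the number of $(x_1,\dots,x_k)\in\mathbb Z^k$ with $n=a_1\frac{x_1(x_1-1)}2+\cdots+a_k\frac{x_k(x_k-1)}2$. *)

theory Defs
  imports Complex_Main
begin

text \<open>
  The coefficients \<open>a\<^sub>1, \<dots>, a\<^sub>k\<close> form a list \<open>as\<close>, and a point of \<open>\<int>\<^sup>k\<close> is an integer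
  list of the same length. For positive coefficients both solution sets are finite, so that
  \<open>card\<close> is a genuine count.
\<close>

definition num_sq_reps :: "nat list \<Rightarrow> nat \<Rightarrow> nat" where
  "num_sq_reps as n =
     card {xs :: int list. length xs = length as \<and>
       int n = (\<Sum>i<length as. int (as ! i) * (xs ! i)\<^sup>2)}"

text \<open>The integer division is exact, since \<open>x * (x - 1)\<close> is even.\<close>

definition num_tri_reps :: "nat list \<Rightarrow> nat \<Rightarrow> nat" where
  "num_tri_reps as n =
     card {xs :: int list. length xs = length as \<and>
       int n = (\<Sum>i<length as. int (as ! i) * ((xs ! i) * (xs ! i - 1) div 2))}"

end

theory Submission
  imports Defs
begin

text \<open>
  Multiplying by 8 and completing squares, the triangular representations of \<open>n\<close> become the
  solutions of \<open>a x\<^sup>2 + 3 a y\<^sup>2 + 8 m z\<^sup>2 = 8 n + 4 a + 8 m\<close> with all of \<open>x, y, z\<close> odd, while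
  \<open>N(a, 3a, 8m; 2n + a + 2m)\<close> counts those with all of \<open>x, y, z\<close> even. In every solution \<open>x\<close> and
  \<open>y\<close> have the same parity. The involution \<open>(x, y) \<mapsto> ((x + 3 y) / 2, (x - y) / 2)\<close> preserves
  \<open>x\<^sup>2 + 3 y\<^sup>2\<close> and exchanges the solutions having \<open>x, y\<close> even with those having \<open>x, y\<close> odd and
  \<open>x \<equiv> y (mod 4)\<close>, which by \<open>y \<mapsto> -y\<close> are half of those having \<open>x, y\<close> odd. So, for any
  restriction on \<open>z\<close>, the odd pairs are twice as many as the even ones.
\<close>

text \<open>Triples replace lists so that parity conditions and coordinate maps can be written by
  pattern matching.\<close>

definition ternary_sols :: "nat \<Rightarrow> nat \<Rightarrow> nat \<Rightarrow> nat \<Rightarrow> (int \<times> int \<times> int) set" where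
  "ternary_sols a b c n =
     {(x, y, z). int a * x\<^sup>2 + int b * y\<^sup>2 + int c * z\<^sup>2 = int n}"

lemma card_lists_of_length_3:
  "card {xs :: 'a list. length xs = 3 \<and> P (xs ! 0) (xs ! 1) (xs ! 2)} = card {(x, y, z). P x y z}"
proof -
  have "bij_betw (\<lambda>(x, y, z). [x, y, z]) {(x, y, z). P x y z}
    {xs. length xs = 3 \<and> P (xs ! 0) (xs ! 1) (xs ! 2)}"
    by (rule bij_betw_byWitness[where f' = "\<lambda>xs. (xs ! 0, xs ! 1, xs ! 2)"])
      (auto simp: numeral_eq_Suc length_Suc_conv)
  then show ?thesis by (simp add: bij_betw_same_card)
qed

lemma num_sq_reps_ternary: "num_sq_reps [a, b, c] n = card (ternary_sols a b c n)"
proof -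
  have "num_sq_reps [a, b, c] n = card {xs :: int list. length xs = 3 \<and>
      int a * (xs ! 0)\<^sup>2 + int b * (xs ! 1)\<^sup>2 + int c * (xs ! 2)\<^sup>2 = int n}"
    unfolding num_sq_reps_def
    by (rule arg_cong[where f = card]) (auto simp: numeral_eq_Suc)
  then show ?thesis
    unfolding ternary_sols_def
    by (simp only: card_lists_of_length_3[where P = "\<lambda>x y z.
      int a * x\<^sup>2 + int b * y\<^sup>2 + int c * z\<^sup>2 = int n"])
qed

text \<open>Since \<open>(2 * x - 1)^2 = 8 * (x * (x - 1) div 2) + 1\<close>, applying
  \<open>x \<mapsto> 2 * x - 1\<close> to each coordinate is a bijection onto the odd solutions; the
  three summands 1, weighted by the coefficients, give the shift \<open>a + b + c\<close>.\<close>

lemma num_tri_reps_ternary: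
  "num_tri_reps [a, b, c] n =
     card {(x, y, z) \<in> ternary_sols a b c (8 * n + a + b + c). odd x \<and> odd y \<and> odd z}"
proof -
  let ?t = "\<lambda>x :: int. x * (x - 1) div 2"
  let ?P = "\<lambda>x y z. int a * ?t x + int b * ?t y + int c * ?t z = int n"
  have "num_tri_reps [a, b, c] n =
      card {xs :: int list. length xs = 3 \<and> ?P (xs ! 0) (xs ! 1) (xs ! 2)}"
    unfolding num_tri_reps_def
    by (rule arg_cong[where f = card]) (auto simp: numeral_eq_Suc)
  also have "\<dots> = card {(x, y, z). ?P x y z}"
    by (rule card_lists_of_length_3)
  also have "\<dots> = card {(x, y, z) \<in> ternary_sols a b c (8 * n + a + b + c).
      odd x \<and> odd y \<and> odd z}"
  proof (rule bij_betw_same_card)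
    have sq: "(2 * x - 1)\<^sup>2 = 8 * ?t x + 1" for x :: int
    proof -
      have "2 * ?t x = x * (x - 1)" by simp
      moreover have "(2 * x - 1)\<^sup>2 = 4 * (x * (x - 1)) + 1"
        by (simp add: power2_eq_square algebra_simps)
      ultimately show ?thesis by linarith
    qed
    have iff: "(2 * x - 1, 2 * y - 1, 2 * z - 1) \<in> ternary_sols a b c (8 * n + a + b + c)
        \<longleftrightarrow> ?P x y z" for x y z :: int
      unfolding ternary_sols_def by (simp add: sq distrib_left) linarith
    have odd_form: "\<exists>k. x = 2 * k - 1" if "odd x" for x :: int
      using that by presburger
    show "bij_betw (\<lambda>(x, y, z). (2 * x - 1, 2 * y - 1, 2 * z - 1)) {(x, y, z). ?P x y z}
      {(x, y, z) \<in> ternary_sols a b c (8 * n + a + b + c). odd x \<and> odd y \<and> odd z}"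
      unfolding bij_betw_def
    proof
      show "inj_on (\<lambda>(x, y, z). (2 * x - 1, 2 * y - 1, 2 * z - 1 :: int)) {(x, y, z). ?P x y z}"
        by (auto simp: inj_on_def)
      show "(\<lambda>(x, y, z). (2 * x - 1, 2 * y - 1, 2 * z - 1)) ` {(x, y, z). ?P x y z} =
        {(x, y, z) \<in> ternary_sols a b c (8 * n + a + b + c). odd x \<and> odd y \<and> odd z}"
        (is "?L = ?R")
      proof
        show "?L \<subseteq> ?R" by (auto simp: iff)
        show "?R \<subseteq> ?L"
        proof
          fix p assume "p \<in> ?R"
          then obtain x y z where p: "p = (x, y, z)"
            "(x, y, z) \<in> ternary_sols a b c (8 * n + a + b + c)" "odd x" "odd y" "odd z"
            by auto
          obtain u v w where "x = 2 * u - 1" "y = 2 * v - 1" "z = 2 * w - 1"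
            using p(3-5) odd_form by metis
          with p(1,2) iff[of u v w] show "p \<in> ?L"
            by (auto intro!: image_eqI[where x = "(u, v, w)"])
        qed
      qed
    qed
  qed
  finally show ?thesis .
qed

text \<open>Makes \<open>card\<close> additive on disjoint unions of solution sets. Each term of the
  sum is at most \<open>n\<close>, and \<open>\<bar>x\<bar> \<le> x^2 \<le> k * x^2\<close> bounds
  the coordinate.\<close>

lemma finite_ternary_sols:
  assumes "a > 0" "b > 0" "c > 0"
  shows "finite (ternary_sols a b c n)"
proof (rule finite_subset)
  have bound: "x \<in> {- int n..int n}" if "k > 0" "int k * x\<^sup>2 \<le> int n" for k and x :: int
  proof -
    have "\<bar>x\<bar> \<le> \<bar>x\<bar>\<^sup>2" using self_le_power[of "\<bar>x\<bar>" 2] by (cases "x = 0") auto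
    also have "\<bar>x\<bar>\<^sup>2 \<le> int k * x\<^sup>2" using that(1) by (simp add: mult_le_cancel_right1)
    finally show ?thesis using that(2) by auto
  qed
  show "ternary_sols a b c n \<subseteq> {- int n..int n} \<times> {- int n..int n} \<times> {- int n..int n}"
  proof
    fix p assume "p \<in> ternary_sols a b c n"
    then obtain x y z where p: "p = (x, y, z)" and
      eq: "int a * x\<^sup>2 + int b * y\<^sup>2 + int c * z\<^sup>2 = int n"
      by (auto simp: ternary_sols_def)
    have "0 \<le> int a * x\<^sup>2" "0 \<le> int b * y\<^sup>2" "0 \<le> int c * z\<^sup>2" by simp_all
    with eq have "int a * x\<^sup>2 \<le> int n" "int b * y\<^sup>2 \<le> int n" "int c * z\<^sup>2 \<le> int n"
      by linarith+
    with assms show "p \<in> {- int n..int n} \<times> {- int n..int n} \<times> {- int n..int n}"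
      unfolding p using bound by blast
  qed
qed simp

lemma card_ternary_sols_all_even:
  "card {(x, y, z) \<in> ternary_sols a b c (4 * n). even x \<and> even y \<and> even z} =
     card (ternary_sols a b c n)"
proof -
  have "{(x, y, z) \<in> ternary_sols a b c (4 * n). even x \<and> even y \<and> even z} =
      (\<lambda>(x, y, z). (2 * x, 2 * y, 2 * z)) ` ternary_sols a b c n"
    by (auto simp: ternary_sols_def image_iff elim!: evenE)
  moreover have "inj_on (\<lambda>(x, y, z). (2 * x, 2 * y, 2 * z :: int)) (ternary_sols a b c n)"
    by (auto simp: inj_on_def)
  ultimately show ?thesis by (simp add: card_image)
qed

text \<open>The predicate \<open>p\<close> is arbitrary because every map involved fixes
  \<open>z\<close>. The total is \<open>4 * a\<close> modulo 8 with \<open>a\<close> odd, which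
  prevents the halves of an even pair from having equal parity.\<close>

lemma card_odd_pairs_eq_twice_even_pairs:
  fixes a c n :: nat
  assumes "odd a" "c > 0"
  defines "S \<equiv> ternary_sols a (3 * a) (8 * c) (8 * n + 4 * a)"
  shows "card {(x, y, z) \<in> S. odd x \<and> odd y \<and> p z} =
    2 * card {(x, y, z) \<in> S. even x \<and> even y \<and> p z}"
proof -
  let ?E = "{(x, y, z) \<in> S. even x \<and> even y \<and> p z}"
  let ?A = "{(x, y, z) \<in> S. odd x \<and> odd y \<and> p z \<and> 4 dvd x - y}"
  let ?B = "{(x, y, z) \<in> S. odd x \<and> odd y \<and> p z \<and> 4 dvd x + y}"
  have fin: "finite S"
    unfolding S_def using assms(1,2) by (intro finite_ternary_sols) (auto intro: odd_pos)
  have S_iff: "(x, y, z) \<in> S \<longleftrightarrow>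
      int a * (x\<^sup>2 + 3 * y\<^sup>2) + 8 * (int c * z\<^sup>2) = 8 * int n + 4 * int a" for x y z
    by (simp add: S_def ternary_sols_def algebra_simps)
  \<comment> \<open>On \<open>x + y * sqrt(-3)\<close> this is conjugation followed by
    multiplication by the sixth root of unity \<open>(1 + sqrt(-3)) / 2\<close>, hence a
    norm-preserving involution. The divisions are exact when \<open>x\<close> and \<open>y\<close>
    have equal parity.\<close>
  let ?f = "\<lambda>(x :: int, y :: int, z :: int). ((x + 3 * y) div 2, (x - y) div 2, z)"
  \<comment> \<open>Dividing the equation by 4 leaves an odd right-hand side, and
    \<open>u^2 + 3 * v^2\<close> has the parity of \<open>u + v\<close>.\<close>
  have half: "odd (u + v)" if "(2 * u, 2 * v, z) \<in> S" for u v z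
  proof -
    from that have "int a * (u\<^sup>2 + 3 * v\<^sup>2) + 2 * (int c * z\<^sup>2) = 2 * int n + int a"
      by (simp add: S_iff power_mult_distrib algebra_simps)
    then have "odd (int a * (u\<^sup>2 + 3 * v\<^sup>2) + 2 * (int c * z\<^sup>2))"
      using assms(1) by simp
    then show ?thesis by simp
  qed
  have "bij_betw ?f ?E ?A"
  proof (rule bij_betw_byWitness[where f' = ?f])
    show "\<forall>p\<in>?E. ?f (?f p) = p" by (auto elim!: evenE)
    show "\<forall>p\<in>?A. ?f (?f p) = p"
    proof clarsimp
      fix x y :: int assume "4 dvd x - y"
      then obtain k where k: "x = y + 4 * k" by (auto elim!: dvdE simp: algebra_simps)
      have "(x + 3 * y) div 2 = 2 * (y + k)" "(x - y) div 2 = 2 * k" using k by auto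
      then show "((x + 3 * y) div 2 + 3 * ((x - y) div 2)) div 2 = x \<and>
          ((x + 3 * y) div 2 - (x - y) div 2) div 2 = y"
        using k by simp
    qed
    show "?f ` ?E \<subseteq> ?A"
    proof clarify
      fix x y z assume *: "(x, y, z) \<in> S" "even x" "even y" "p z"
      then obtain u v where uv: "x = 2 * u" "y = 2 * v" by (auto elim!: evenE)
      have f: "(x + 3 * y) div 2 = u + 3 * v" "(x - y) div 2 = u - v" using uv by auto
      have "(u + 3 * v)\<^sup>2 + 3 * (u - v)\<^sup>2 = x\<^sup>2 + 3 * y\<^sup>2"
        unfolding uv by (simp add: power2_eq_square algebra_simps)
      then have "(u + 3 * v, u - v, z) \<in> S" using *(1) by (simp add: S_iff)
      \<comment> \<open>Both \<open>u + 3 * v\<close> and \<open>u - v\<close> have the parity of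
        \<open>u + v\<close>, and they differ by \<open>4 * v\<close>.\<close>
      moreover have "odd (u + v)" using half * uv by blast
      ultimately show "((x + 3 * y) div 2, (x - y) div 2, z) \<in> S \<and>
          odd ((x + 3 * y) div 2) \<and> odd ((x - y) div 2) \<and> p z \<and>
          4 dvd (x + 3 * y) div 2 - (x - y) div 2"
        using *(4) unfolding f by simp
    qed
    show "?f ` ?A \<subseteq> ?E"
    proof clarify
      fix x y z assume *: "(x, y, z) \<in> S" "odd x" "odd y" "p z" "4 dvd x - y"
      then obtain k where k: "x = y + 4 * k" by (auto elim!: dvdE simp: algebra_simps)
      have f: "(x + 3 * y) div 2 = 2 * (y + k)" "(x - y) div 2 = 2 * k" using k by auto
      have "(2 * (y + k))\<^sup>2 + 3 * (2 * k)\<^sup>2 = x\<^sup>2 + 3 * y\<^sup>2"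
        unfolding k by (simp add: power2_eq_square algebra_simps)
      then have "(2 * (y + k), 2 * k, z) \<in> S" using *(1) by (simp only: S_iff)
      then show "((x + 3 * y) div 2, (x - y) div 2, z) \<in> S \<and>
          even ((x + 3 * y) div 2) \<and> even ((x - y) div 2) \<and> p z"
        using *(4) unfolding f by simp
    qed
  qed
  then have A: "card ?A = card ?E" by (simp add: bij_betw_same_card)
  have "bij_betw (\<lambda>(x, y, z). (x, - y, z)) ?A ?B"
    by (rule bij_betw_byWitness[where f' = "\<lambda>(x, y, z). (x, - y, z)"]) (auto simp: S_iff)
  then have B: "card ?B = card ?E" using A by (simp add: bij_betw_same_card)
  \<comment> \<open>For odd \<open>x\<close> and \<open>y\<close>, both \<open>x - y\<close> and
    \<open>x + y\<close> are even with sum \<open>2 * x\<close>, which is 2 modulo 4; so exactly one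
    of them is divisible by 4.\<close>
  have "{(x, y, z) \<in> S. odd x \<and> odd y \<and> p z} = ?A \<union> ?B"
  proof -
    have "4 dvd x - y \<or> 4 dvd x + y" if "odd x" "odd y" for x y :: int
      using that by presburger
    then show ?thesis by auto
  qed
  moreover have "?A \<inter> ?B = {}"
  proof -
    have "\<not> (4 dvd x - y \<and> 4 dvd x + y)" if "odd x" "odd y" for x y :: int
      using that by presburger
    then show ?thesis by auto
  qed
  moreover have "finite ?A" "finite ?B"
    by (rule finite_subset[OF _ fin], auto)+
  ultimately show ?thesis using A B by (simp add: card_Un_disjoint)
qed

theorem theorem3p2:
  fixes a m n :: nat
  assumes "odd a" and "m > 0" and "n > 0"
  shows "real (num_tri_reps [a, 3 * a, 8 * m] n) =
    2 / 3 * real (num_sq_reps [a, 3 * a, 8 * m] (8 * n + 4 * a + 8 * m))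
    - 2 * real (num_sq_reps [a, 3 * a, 8 * m] (2 * n + a + 2 * m))"
proof -
  define S where "S = ternary_sols a (3 * a) (8 * m) (8 * n + 4 * a + 8 * m)"
  define odds where "odds p = {(x, y, z) \<in> S. odd x \<and> odd y \<and> p z}" for p :: "int \<Rightarrow> bool"
  define evens where "evens p = {(x, y, z) \<in> S. even x \<and> even y \<and> p z}" for p :: "int \<Rightarrow> bool"
  have fin: "finite S"
    unfolding S_def using assms by (intro finite_ternary_sols) (auto intro: odd_pos)
  have fin': "finite (odds p)" "finite (evens p)" for p
    unfolding odds_def evens_def by (rule finite_subset[OF _ fin], auto)+
  have S_eq: "S = ternary_sols a (3 * a) (8 * m) (8 * (n + m) + 4 * a)"
    by (simp add: S_def algebra_simps)
  have twice: "card (odds p) = 2 * card (evens p)" for p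
    unfolding odds_def evens_def S_eq using assms
    by (intro card_odd_pairs_eq_twice_even_pairs) auto
  \<comment> \<open>Modulo 2 the equation reduces to \<open>x^2 + 3 * y^2\<close> being even, as
    \<open>a\<close> is odd.\<close>
  have "even x \<longleftrightarrow> even y" if "(x, y, z) \<in> S" for x y z
  proof -
    have "int a * (x\<^sup>2 + 3 * y\<^sup>2) = 2 * (4 * int n + 2 * int a + 4 * int m - 4 * (int m * z\<^sup>2))"
      using that by (simp add: S_def ternary_sols_def algebra_simps)
    then have "even (int a * (x\<^sup>2 + 3 * y\<^sup>2))" by simp
    then show ?thesis using assms(1) by simp
  qed
  then have "S = odds (\<lambda>_. True) \<union> evens (\<lambda>_. True)"
    unfolding odds_def evens_def by auto
  moreover have "odds (\<lambda>_. True) \<inter> evens (\<lambda>_. True) = {}"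
    by (auto simp: odds_def evens_def)
  ultimately have cardS: "card S = 3 * card (evens (\<lambda>_. True))"
    using twice fin' by (simp add: card_Un_disjoint)
  have "odds (\<lambda>_. True) = odds odd \<union> odds even" "odds odd \<inter> odds even = {}"
    by (auto simp: odds_def)
  then have odds_split: "card (odds (\<lambda>_. True)) = card (odds odd) + card (odds even)"
    using fin' by (simp add: card_Un_disjoint)
  have "num_tri_reps [a, 3 * a, 8 * m] n = card (odds odd)"
    by (simp add: num_tri_reps_ternary odds_def S_def algebra_simps)
  moreover have "num_sq_reps [a, 3 * a, 8 * m] (8 * n + 4 * a + 8 * m) = card S"
    by (simp add: num_sq_reps_ternary S_def)
  moreover have "num_sq_reps [a, 3 * a, 8 * m] (2 * n + a + 2 * m) = card (evens even)"
    using card_ternary_sols_all_even[of a "3 * a" "8 * m" "2 * n + a + 2 * m"]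
    by (simp add: num_sq_reps_ternary evens_def S_def algebra_simps)
  \<comment> \<open>With \<open>E\<close> solutions having \<open>x, y\<close> even and
    \<open>F\<close> having all three even, \<open>card S = 3 * E\<close> and
    \<open>card (odds odd) = 2 * E - 2 * F\<close>, which is
    \<open>2 / 3 * card S - 2 * F\<close>.\<close>
  ultimately show ?thesis using cardS odds_split twice[of even] twice[of "\<lambda>_. True"] by simp
qed

end
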